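(* Let $N\geq 3$ be an integer and let $h:[0,\infty)\to[0,\infty)$ and $g:(0,\infty)\to\mathbb{R}$ be functions satisfying the following. (h1) $h$ is continuous and nondecreasing, $h(0)=0$, and $h(s)>0$ for all $s\in(0,\infty)$. (g1) $g$ is continuous and there exists $s_0\in(0,\infty)$ such that $g$ is nondecreasing on $(s_0,\infty)$, $\lim_{s\to 0+}g(s)=g(s_0)=0$, $g(s)<0$ for all $s\in(0,s_0)$, and $g(s)>0$ for all $s\in(s_0,\infty)$. (O) For this $s_0$ and for every $c>s_0$, $\displaystyle \lim_{t\to\infty}\int_{c}^{t}\frac{1}{h(\tau)+g(\tau)}\,d\tau=\infty$. Let $a,b$ be nonnegative continuous spherically symmetric functions on $\mathbb{R}^N$, written $a(r),b(r)$ with $r=|x|$. Let $u_0\geq s_0$ be a real number, and define functions $u_n:[0,\infty)\to\mathbb{R}$ by letting the initial iterate (index $n=0$) be the constant function equal to $u_0$ and, for $n\geq 1$ and $r\geq 0$, $$u_n(r)=u_0+\int_0^r t^{1-N}\int_0^t s^{N-1}\bigl(a(s)h(u_{n-1}(s))+b(s)g(u_{n-1}(s))\bigr)\,ds\,dt .$$ Let $u\in C^2[0,\infty)$ be the locally uniform limit of $(u_n)$ on $[0,\infty)$, which is a positive spherically symmetric solution of $\Delta u=a(|x|)h(u)+b(|x|)g(u)$ on $\mathbb{R}^N$ with $u(0)=u_0$. If $a$ and $b$ are nondecreasing functions of $r$ on $[0,\infty)$, then $u$ is convex (as a function of $r\in[0,\infty)$).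
   Context: $|x|$ denotes the Euclidean norm on $\mathbb{R}^N$. A function on $\mathbb{R}^N$ is spherically symmetric if it depends only on $r=|x|$; such a function is identified with the corresponding function of $r\in[0,\infty)$. Under the stated hypotheses (without the monotonicity of $a$ and $b$) it is known that the sequence $(u_n)$ converges locally uniformly on $[0,\infty)$ to a positive function $u\in C^2[0,\infty)$ such that $x\mapsto u(|x|)$ solves the equation with $u(0)=u_0$. *)

theory Defs
  imports "HOL-Analysis.Analysis"
begin

(* One-sided derivatives at end points of S are meant. *)
definition C2_on :: "real set \<Rightarrow> (real \<Rightarrow> real) \<Rightarrow> bool" where
  "C2_on S f \<longleftrightarrow> (\<exists>f' f''.
     (\<forall>x\<in>S. (f has_real_derivative f' x) (at x within S)) \<and>
     (\<forall>x\<in>S. (f' has_real_derivative f'' x) (at x within S)) \<and>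
     continuous_on S f'')"

definition partial_deriv :: "'a::euclidean_space \<Rightarrow> ('a \<Rightarrow> real) \<Rightarrow> 'a \<Rightarrow> real" where
  "partial_deriv i f x = deriv (\<lambda>t. f (x + t *\<^sub>R i)) 0"

definition has_partial_deriv_at :: "'a::euclidean_space \<Rightarrow> ('a \<Rightarrow> real) \<Rightarrow> 'a \<Rightarrow> bool" where
  "has_partial_deriv_at i f x \<longleftrightarrow> (\<lambda>t. f (x + t *\<^sub>R i)) differentiable (at (0::real))"

(* The class C^2 on the whole space: f and its partial derivatives up to order two
   exist everywhere and are continuous. *)
definition C2_space :: "('a::euclidean_space \<Rightarrow> real) \<Rightarrow> bool" where
  "C2_space f \<longleftrightarrow> continuous_on UNIV f \<and>
     (\<forall>i\<in>Basis. (\<forall>x. has_partial_deriv_at i f x) \<and> continuous_on UNIV (partial_deriv i f)) \<and>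
     (\<forall>i\<in>Basis. \<forall>j\<in>Basis. (\<forall>x. has_partial_deriv_at j (partial_deriv i f) x) \<and>
        continuous_on UNIV (partial_deriv j (partial_deriv i f)))"

definition laplacian :: "('a::euclidean_space \<Rightarrow> real) \<Rightarrow> 'a \<Rightarrow> real" where
  "laplacian f x = (\<Sum>i\<in>Basis. partial_deriv i (partial_deriv i f) x)"

(* Only arguments r >= 0 are meaningful.  The exponent 1 - N is a negative integer;
   the value of the outer integrand at the single point t = 0 is immaterial. *)
primrec radial_iterate ::
  "nat \<Rightarrow> (real \<Rightarrow> real) \<Rightarrow> (real \<Rightarrow> real) \<Rightarrow> (real \<Rightarrow> real) \<Rightarrow> (real \<Rightarrow> real) \<Rightarrow> real
    \<Rightarrow> nat \<Rightarrow> real \<Rightarrow> real" where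
  "radial_iterate N h g a b u0 0 = (\<lambda>r. u0)"
| "radial_iterate N h g a b u0 (Suc n) = (\<lambda>r. u0 +
     integral {0..r} (\<lambda>t. t powi (1 - int N) *
       integral {0..t} (\<lambda>s. s ^ (N - 1) *
         (a s * h (radial_iterate N h g a b u0 n s) + b s * g (radial_iterate N h g a b u0 n s)))))"

end

(* If f is nonnegative and nondecreasing, then the substitution s = t x turns
   t^(1-N) * integral {0..t} (s^(N-1) * f s) into t * integral {0..1} (x^(N-1) * f (t x)),
   which is visibly nondecreasing in t.  So every iterate is u0 plus the primitive of a
   nonnegative nondecreasing function; it is convex and nondecreasing with values in
   [s0, \<infinity>), where h and g are nondecreasing, so the argument iterates, and
   convexity passes to the pointwise limit. *)

theory Submission
  imports Defs
begin

lemma mono_on_mult_nonneg: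
  fixes f g :: "real \<Rightarrow> real"
  assumes "mono_on S f" "mono_on S g" "\<And>x. x \<in> S \<Longrightarrow> f x \<ge> 0" "\<And>x. x \<in> S \<Longrightarrow> g x \<ge> 0"
  shows "mono_on S (\<lambda>x. f x * g x)"
  using assms by (auto intro!: mono_onI mult_mono dest: mono_onD)

text \<open>\<open>G\<close> may be discontinuous, so no derivative of the primitive is taken.
  Instead, at an intermediate point \<open>z\<close>, the value \<open>G z\<close> bounds the mean
  of \<open>G\<close> from above on the left interval and from below on the right one, so the chord
  slopes increase.\<close>

lemma convex_on_integral_mono:
  fixes G :: "real \<Rightarrow> real"
  assumes mono: "mono_on {a..} G"
  shows "convex_on {a..} (\<lambda>r. integral {a..r} G)"
proof (rule convex_on_linorderI)
  fix t x y :: real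
  assume t: "t > 0" "t < 1" and x: "x \<in> {a..}" and y: "y \<in> {a..}" and xy: "x < y"
  define z where "z = (1 - t) * x + t * y"
  have zx: "z - x = t * (y - x)" and yz: "y - z = (1 - t) * (y - x)"
    by (simp_all add: z_def algebra_simps)
  have z: "x < z" "z < y"
    using t xy mult_pos_pos[of t "y - x"] mult_pos_pos[of "1 - t" "y - x"] zx yz by linarith+
  have int: "G integrable_on {p..q}" if "p \<ge> a" for p q
    using that by (intro integrable_on_mono_on mono_on_subset[OF mono]) auto
  have "integral {a..x} G + integral {x..z} G = integral {a..z} G"
    using x z int by (intro Henstock_Kurzweil_Integration.integral_combine) auto
  moreover have "integral {a..z} G + integral {z..y} G = integral {a..y} G"
    using x z int by (intro Henstock_Kurzweil_Integration.integral_combine) auto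
  moreover have "integral {x..z} G \<le> integral {x..z} (\<lambda>_. G z)"
    using x z by (intro integral_le int integrable_const_ivl) (auto intro: mono_onD[OF mono])
  moreover have "integral {z..y} (\<lambda>_. G z) \<le> integral {z..y} G"
    using x z by (intro integral_le int integrable_const_ivl) (auto intro: mono_onD[OF mono])
  moreover have "integral {x..z} (\<lambda>_. G z) = t * ((y - x) * G z)"
    "integral {z..y} (\<lambda>_. G z) = (1 - t) * ((y - x) * G z)"
    using z by (simp_all flip: zx yz mult.assoc)
  ultimately have *: "integral {a..z} G - integral {a..x} G \<le> t * ((y - x) * G z)"
      "(1 - t) * ((y - x) * G z) \<le> integral {a..y} G - integral {a..z} G"
    by linarith+
  \<comment> \<open>The weights \<open>1 - t\<close> and \<open>t\<close> turn both bounds into the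
    common quantity \<open>t * (1 - t) * (y - x) * G z\<close>, through which the two increments are
    compared.\<close>
  have "(1 - t) * (integral {a..z} G - integral {a..x} G) \<le> t * ((1 - t) * ((y - x) * G z))"
    using mult_left_mono[OF *(1), of "1 - t"] t by (simp add: mult.left_commute)
  also have "\<dots> \<le> t * (integral {a..y} G - integral {a..z} G)"
    using mult_left_mono[OF *(2), of t] t by simp
  finally have "integral {a..z} G \<le> (1 - t) * integral {a..x} G + t * integral {a..y} G"
    by (simp only: left_diff_distrib right_diff_distrib)
  then show "integral {a..(1 - t) *\<^sub>R x + t *\<^sub>R y} G
      \<le> (1 - t) * integral {a..x} G + t * integral {a..y} G"
    by (simp add: z_def)
qed simp

lemma mono_on_integral_nonneg:
  fixes G :: "real \<Rightarrow> real"
  assumes mono: "mono_on {a..} G" and nonneg: "\<And>t. t \<ge> a \<Longrightarrow> G t \<ge> 0"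
  shows "mono_on {a..} (\<lambda>r. integral {a..r} G)"
  using nonneg
  by (intro mono_onI integral_subset_le integrable_on_mono_on mono_on_subset[OF mono]) auto

text \<open>Under \<open>s = t * x\<close>, the weight \<open>s ^ (N - 1)\<close> and
  \<open>ds\<close> together contribute \<open>t ^ N\<close>, of which the prefactor leaves a single
  \<open>t\<close>.\<close>

lemma radial_average_rescale:
  fixes f :: "real \<Rightarrow> real"
  assumes "N > 0" "t > 0" and int: "(\<lambda>s. s ^ (N - 1) * f s) integrable_on {0..t}"
  shows "t powi (1 - int N) * integral {0..t} (\<lambda>s. s ^ (N - 1) * f s)
    = t * integral {0..1} (\<lambda>x. x ^ (N - 1) * f (t * x))"
proof -
  have img: "(\<lambda>x. x / t) ` {0..t} = {0..1}"
    using \<open>t > 0\<close> by (simp add: image_divide_atLeastAtMost)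
  have "((\<lambda>x. (t * x) ^ (N - 1) * f (t * x)) has_integral
      (1 / \<bar>t\<bar>) *\<^sub>R integral {0..t} (\<lambda>s. s ^ (N - 1) * f s)) {0..1}"
    using has_integral_stretch_real[OF integrable_integral[OF int], of t] \<open>t > 0\<close> img by simp
  then have "t ^ (N - 1) * integral {0..1} (\<lambda>x. x ^ (N - 1) * f (t * x))
      = integral {0..t} (\<lambda>s. s ^ (N - 1) * f s) / t"
    \<comment> \<open>The constant \<open>t ^ (N - 1)\<close> is moved under the integral so that
      the integrand matches the stretched one.\<close>
    using \<open>t > 0\<close> unfolding integral_mult_right[symmetric]
    by (intro integral_unique) (simp add: power_mult_distrib mult.assoc)
  then have "integral {0..t} (\<lambda>s. s ^ (N - 1) * f s)
      = t * t ^ (N - 1) * integral {0..1} (\<lambda>x. x ^ (N - 1) * f (t * x))"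
    using \<open>t > 0\<close> by (simp add: mult.assoc)
  moreover have "1 - int N = - int (N - 1)"
    using \<open>N > 0\<close> by simp
  then have "t powi (1 - int N) = inverse (t ^ (N - 1))"
    by (simp only: power_int_minus power_int_of_nat)
  ultimately show ?thesis
    using \<open>t > 0\<close> by simp
qed

text \<open>In the rescaled form both factors, \<open>t\<close> and the integral over the fixed
  interval \<open>{0..1}\<close>, are nonnegative and nondecreasing in \<open>t\<close>, hence so is
  their product.\<close>

lemma mono_on_radial_average:
  fixes f :: "real \<Rightarrow> real"
  assumes "N > 0" and mono: "mono_on {0..} f" and nonneg: "\<And>s. s \<ge> 0 \<Longrightarrow> f s \<ge> 0"
  shows "mono_on {0..} (\<lambda>t. t powi (1 - int N) * integral {0..t} (\<lambda>s. s ^ (N - 1) * f s))"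
    (is "mono_on _ ?G")
proof (rule mono_onI)
  fix p q :: real
  assume p: "p \<in> {0..}" and "q \<in> {0..}" and pq: "p \<le> q"
  have pow: "mono_on {0..} (\<lambda>s::real. s ^ (N - 1))"
    by (auto intro!: mono_onI power_mono)
  \<comment> \<open>Integrability is drawn from monotonicity, as a product of nonnegative
    nondecreasing functions.\<close>
  have int: "(\<lambda>s. s ^ (N - 1) * f s) integrable_on {0..t}" for t
    by (intro integrable_on_mono_on mono_on_subset[OF mono_on_mult_nonneg[OF pow mono]] nonneg) auto
  \<comment> \<open>The rescaling needs \<open>t > 0\<close>; at \<open>t = 0\<close> both sides
    vanish, the left one because its integral is over a single point.\<close>
  have G: "?G t = t * integral {0..1} (\<lambda>x. x ^ (N - 1) * f (t * x))" if "t \<ge> 0" for t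
    using that radial_average_rescale[OF \<open>N > 0\<close> _ int, of t] by (cases "t = 0") auto
  have int1: "(\<lambda>x. x ^ (N - 1) * f (t * x)) integrable_on {0..1}" if "t \<ge> 0" for t
    using that
    by (intro integrable_on_mono_on mono_on_mult_nonneg mono_on_subset[OF pow])
       (auto intro!: mono_onI mono_onD[OF mono] nonneg mult_left_mono)
  have "integral {0..1} (\<lambda>x. x ^ (N - 1) * f (p * x)) \<le> integral {0..1} (\<lambda>x. x ^ (N - 1) * f (q * x))"
    using p pq
    by (intro integral_le int1) (auto intro!: mult_left_mono mono_onD[OF mono] mult_right_mono)
  moreover have "integral {0..1} (\<lambda>x. x ^ (N - 1) * f (p * x)) \<ge> 0"
    using p by (intro integral_nonneg int1) (auto intro!: mult_nonneg_nonneg nonneg)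
  ultimately show "?G p \<le> ?G q"
    using p pq G by (auto intro!: mult_mono)
qed

lemma radial_average_nonneg:
  fixes f :: "real \<Rightarrow> real"
  assumes "N > 0" "mono_on {0..} f" "\<And>s. s \<ge> 0 \<Longrightarrow> f s \<ge> 0" "t \<ge> 0"
  shows "t powi (1 - int N) * integral {0..t} (\<lambda>s. s ^ (N - 1) * f s) \<ge> 0"
  \<comment> \<open>The comparison point is 0, where the expression has value 0.\<close>
  using mono_onD[OF mono_on_radial_average[OF assms(1-3)], of 0 t] \<open>t \<ge> 0\<close> by simp

text \<open>Monotonicity and the bound \<open>u0\<close> are carried along with convexity because
  they drive the induction: they keep the previous iterate where \<open>h\<close> and
  \<open>g\<close> are nonnegative and nondecreasing, so the next source term \<open>f\<close> has
  both properties as well.\<close>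

lemma radial_iterate_mono_convex:
  fixes h g a b :: "real \<Rightarrow> real"
  assumes "N > 0"
    and h: "mono_on {u0..} h" "\<And>s. s \<ge> u0 \<Longrightarrow> h s \<ge> 0"
    and g: "mono_on {u0..} g" "\<And>s. s \<ge> u0 \<Longrightarrow> g s \<ge> 0"
    and a: "mono_on {0..} a" "\<And>r. r \<ge> 0 \<Longrightarrow> a r \<ge> 0"
    and b: "mono_on {0..} b" "\<And>r. r \<ge> 0 \<Longrightarrow> b r \<ge> 0"
  shows "mono_on {0..} (radial_iterate N h g a b u0 n) \<and>
    (\<forall>r\<ge>0. radial_iterate N h g a b u0 n r \<ge> u0) \<and>
    convex_on {0..} (radial_iterate N h g a b u0 n)"
proof (induction n)
  case 0
  show ?case by (simp add: mono_on_def convex_on_const)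
next
  case (Suc n)
  define w where "w = radial_iterate N h g a b u0 n"
  define f where "f s = a s * h (w s) + b s * g (w s)" for s
  define G where "G t = t powi (1 - int N) * integral {0..t} (\<lambda>s. s ^ (N - 1) * f s)" for t
  have w: "mono_on {0..} w" "\<And>r. r \<ge> 0 \<Longrightarrow> w r \<ge> u0"
    using Suc by (auto simp: w_def)
  have "mono_on {0..} (\<lambda>s. h (w s))" "mono_on {0..} (\<lambda>s. g (w s))"
    using w by (auto intro!: mono_onI mono_onD[OF h(1)] mono_onD[OF g(1)] dest: mono_onD)
  then have "mono_on {0..} (\<lambda>s. a s * h (w s))" "mono_on {0..} (\<lambda>s. b s * g (w s))"
    using w h g a b by (auto intro!: mono_on_mult_nonneg)
  then have "mono_on {0..} f"
    unfolding f_def by (auto intro!: mono_onI add_mono dest: mono_onD)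
  moreover have "f s \<ge> 0" if "s \<ge> 0" for s
    using that w h g a b by (simp add: f_def)
  ultimately have G: "mono_on {0..} G" "\<And>t. t \<ge> 0 \<Longrightarrow> G t \<ge> 0"
    unfolding G_def using \<open>N > 0\<close> mono_on_radial_average radial_average_nonneg by blast+
  have eq: "radial_iterate N h g a b u0 (Suc n) = (\<lambda>r. u0 + integral {0..r} G)"
    by (simp add: G_def[abs_def] f_def w_def)
  have m: "mono_on {0..} (\<lambda>r. integral {0..r} G)"
    using G by (rule mono_on_integral_nonneg)
  have c: "convex_on {0..} (\<lambda>r. u0 + integral {0..r} G)"
    using G by (intro convex_on_add convex_on_integral_mono) (auto simp: convex_on_const)
  have "integral {0..r} G \<ge> 0" if "r \<ge> 0" for r
    using that mono_onD[OF m, of 0 r] by simp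
  with m c show ?case
    unfolding eq by (auto simp: mono_on_def)
qed

text \<open>For fixed points and weight, convexity is a non-strict inequality between finitely many
  values, so it survives pointwise limits.\<close>

lemma convex_on_LIMSEQ:
  fixes f :: "nat \<Rightarrow> 'a::real_vector \<Rightarrow> real"
  assumes conv: "\<And>n. convex_on S (f n)" and lim: "\<And>x. x \<in> S \<Longrightarrow> (\<lambda>n. f n x) \<longlonglongrightarrow> F x"
  shows "convex_on S F"
proof (rule convex_onI)
  show S: "convex S"
    using conv convex_on_imp_convex by blast
  fix t :: real and x y
  assume t: "0 < t" "t < 1" and xy: "x \<in> S" "y \<in> S"
  then have "(1 - t) *\<^sub>R x + t *\<^sub>R y \<in> S"
    using S by (simp add: convexD)
  then have "(\<lambda>n. f n ((1 - t) *\<^sub>R x + t *\<^sub>R y)) \<longlonglongrightarrow> F ((1 - t) *\<^sub>R x + t *\<^sub>R y)"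
    by (rule lim)
  moreover have "(\<lambda>n. (1 - t) * f n x + t * f n y) \<longlonglongrightarrow> (1 - t) * F x + t * F y"
    using xy by (intro tendsto_intros lim)
  ultimately show "F ((1 - t) *\<^sub>R x + t *\<^sub>R y) \<le> (1 - t) * F x + t * F y"
    by (rule LIMSEQ_le) (use t xy convex_onD[OF conv] in auto)
qed

theorem mainTheorem2:
  fixes h g a b u :: "real \<Rightarrow> real"
    and A B :: "real ^ 'n \<Rightarrow> real"
    and s0 u0 :: real
  assumes N: "CARD('n) \<ge> 3"
    and h_nonneg: "\<forall>s\<ge>0. h s \<ge> 0"
    and h1: "continuous_on {0..} h" "mono_on {0..} h" "h 0 = 0" "\<forall>s>0. h s > 0"
    and g1: "continuous_on {0<..} g" "s0 > 0" "mono_on {s0<..} g"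
      "(g \<longlongrightarrow> 0) (at_right 0)" "g s0 = 0"
      "\<forall>s. 0 < s \<and> s < s0 \<longrightarrow> g s < 0" "\<forall>s>s0. g s > 0"
    and O: "\<forall>c>s0. filterlim (\<lambda>t. integral {c..t} (\<lambda>\<tau>. 1 / (h \<tau> + g \<tau>))) at_top at_top"
    and A: "continuous_on UNIV A" "\<forall>x. A x \<ge> 0" "\<forall>x. A x = a (norm x)"
    and B: "continuous_on UNIV B" "\<forall>x. B x \<ge> 0" "\<forall>x. B x = b (norm x)"
    and u0: "u0 \<ge> s0"
    and u_limit: "\<forall>K. compact K \<and> K \<subseteq> {0..} \<longrightarrow>
      uniform_limit K (radial_iterate CARD('n) h g a b u0) u sequentially"
    and u_C2: "C2_on {0..} u"
    and u_pos: "\<forall>r\<ge>0. u r > 0"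
    and u_at_0: "u 0 = u0"
    and u_solution: "C2_space (\<lambda>x :: real ^ 'n. u (norm x))"
      "\<forall>x :: real ^ 'n. laplacian (\<lambda>y. u (norm y)) x = A x * h (u (norm x)) + B x * g (u (norm x))"
    and mono: "mono_on {0..} a" "mono_on {0..} b"
  shows "convex_on {0..} u"
proof (rule convex_on_LIMSEQ)
  \<comment> \<open>The signs are known for \<open>A\<close> and \<open>B\<close> on the whole
    space; they pass to the profiles since every \<open>r \<ge> 0\<close> is the norm of some
    vector.\<close>
  have nonneg: "a r \<ge> 0" "b r \<ge> 0" if r: "r \<ge> 0" for r
  proof -
    obtain x :: "real ^ 'n" where "norm x = r"
      using vector_choose_size[OF r] .
    then show "a r \<ge> 0" "b r \<ge> 0"
      using A(2,3) B(2,3) by metis+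
  qed
  have g_nonneg: "g s \<ge> 0" if "s \<ge> s0" for s
    using that g1(5,7) by (cases "s = s0") (auto simp: less_imp_le)
  \<comment> \<open>Monotonicity extends from the open ray to its end point because \<open>g\<close>
    vanishes there and is nonnegative beyond. The end point matters: \<open>u0 = s0\<close> is
    allowed, and iterates start at \<open>u0\<close>.\<close>
  have g_mono: "mono_on {s0..} g"
  proof (rule mono_onI)
    fix p q :: real
    assume "p \<in> {s0..}" "q \<in> {s0..}" "p \<le> q"
    then show "g p \<le> g q"
      using g1(5) g_nonneg mono_onD[OF g1(3), of p q] by (cases "p = s0") auto
  qed
  show "convex_on {0..} (radial_iterate CARD('n) h g a b u0 n)" for n
    using radial_iterate_mono_convex[of "CARD('n)" u0 h g a b n] N nonneg mono g1(2) u0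
      mono_on_subset[OF h1(2), of "{u0..}"] h_nonneg mono_on_subset[OF g_mono, of "{u0..}"] g_nonneg
    by auto
  \<comment> \<open>Locally uniform convergence is applied to the compact set
    \<open>{r}\<close>.\<close>
  show "(\<lambda>n. radial_iterate CARD('n) h g a b u0 n r) \<longlonglongrightarrow> u r" if "r \<in> {0..}" for r
    using u_limit[rule_format, of "{r}"] that by (simp add: tendsto_uniform_limitI)
qed

end
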